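(* Let $a<b$, $c<d$, $\Delta=[a,b]\times[c,d]\subset[0,\infty)^2$, and let $f:\Delta\to[0,\infty)$ be an absolutely continuous function on $\Delta$. Let $s\in(0,1]$ and $r_1,r_2\in[0,1]$ be fixed. If $\left|\frac{\partial^2 f}{\partial t\partial\lambda}\right|$ is an $s$-convex function on the co-ordinates on $\Delta$, then $$\Bigg|\frac{f(a,c)+r_2f(a,d)+r_1f(b,c)+r_1r_2f(b,d)}{(r_1+1)(r_2+1)}-\frac{1}{d-c}\left[\left(\frac{r_1}{r_1+1}\right)\int_c^d f(b,y)\,dy+\left(\frac{1}{r_1+1}\right)\int_c^d f(a,y)\,dy\right]$$ $$-\frac{1}{b-a}\left[\left(\frac{r_2}{r_2+1}\right)\int_a^b f(x,d)\,dx+\left(\frac{1}{r_2+1}\right)\int_a^b f(x,c)\,dx\right]+\frac{1}{(b-a)(d-c)}\int_a^b\int_c^d f(x,y)\,dx\,dy\Bigg|$$ $$\le\frac{(b-a)(d-c)}{(r_1+1)(r_2+1)(s+1)^2(s+2)^2}\left(MN\left|\frac{\partial^2 f}{\partial t\partial\lambda}\right|(a,c)+LM\left|\frac{\partial^2 f}{\partial t\partial\lambda}\right|(a,d)+KN\left|\frac{\partial^2 f}{\partial t\partial\lambda}\right|(b,c)+KL\left|\frac{\partial^2 f}{\partial t\partial\lambda}\right|(b,d)\right),$$ where $$M=s+1+2(r_1+1)\left(\frac{r_1}{r_1+1}\right)^{s+2}-r_1,\qquad N=s+1+2(r_2+1)\left(\frac{r_2}{r_2+1}\right)^{s+2}-r_2,$$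 $$L=r_2(s+1)+2\left(\frac{1}{r_2+1}\right)^{s+1}-1,\qquad K=r_1(s+1)+2\left(\frac{1}{r_1+1}\right)^{s+1}-1.$$
   Context: $\frac{\partial^2 f}{\partial t\partial\lambda}$ denotes the second-order mixed partial derivative of $f$ with respect to its first and second variables, on $\Delta$. In $\int_a^b\int_c^d f(x,y)\,dx\,dy$ the variable $x$ ranges over $[a,b]$ and $y$ over $[c,d]$. For fixed $s\in(0,1]$, a real function $h$ on an interval in $[0,\infty)$ is $s$-convex (in the second sense) if $h(\alpha x+\beta y)\le\alpha^s h(x)+\beta^s h(y)$ for all $x,y$ in the interval and $\alpha,\beta\ge0$ with $\alpha+\beta=1$. A function $g:[a,b]\times[c,d]\to\mathbb{R}$ is $s$-convex on the co-ordinates if the partial mappings $u\mapsto g(u,y)$ on $[a,b]$ (for every $y\in[c,d]$) and $v\mapsto g(x,v)$ on $[c,d]$ (for every $x\in[a,b]$) are $s$-convex in this sense. *)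

theory Defs
  imports "HOL-Analysis.Analysis"
begin

definition s_convex_on :: "real \<Rightarrow> real set \<Rightarrow> (real \<Rightarrow> real) \<Rightarrow> bool" where
  "s_convex_on s I h \<longleftrightarrow>
     (\<forall>x\<in>I. \<forall>y\<in>I. \<forall>\<alpha>\<ge>0. \<forall>\<beta>\<ge>0. \<alpha> + \<beta> = 1 \<longrightarrow>
        h (\<alpha> * x + \<beta> * y) \<le> \<alpha> powr s * h x + \<beta> powr s * h y)"

definition s_convex_on_coordinates ::
    "real \<Rightarrow> real set \<Rightarrow> real set \<Rightarrow> (real \<times> real \<Rightarrow> real) \<Rightarrow> bool" where
  "s_convex_on_coordinates s X Y g \<longleftrightarrow>
     (\<forall>y\<in>Y. s_convex_on s X (\<lambda>u. g (u, y))) \<and>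
     (\<forall>x\<in>X. s_convex_on s Y (\<lambda>v. g (x, v)))"

text \<open>The classical epsilon-delta definition. The families \<open>\<D>\<close> are finite families of
  pairwise non-overlapping compact intervals contained in \<open>I\<close>; they need not cover \<open>I\<close>.\<close>

definition abs_continuous_on :: "real set \<Rightarrow> (real \<Rightarrow> real) \<Rightarrow> bool" where
  "abs_continuous_on I h \<longleftrightarrow>
     (\<forall>\<epsilon>>0. \<exists>\<delta>>0. \<forall>\<D>. \<D> division_of \<Union>\<D> \<and> \<Union>\<D> \<subseteq> I \<and> (\<Sum>J\<in>\<D>. measure lborel J) < \<delta> \<longrightarrow>
        (\<Sum>J\<in>\<D>. \<bar>h (interval_upperbound J) - h (interval_lowerbound J)\<bar>) < \<epsilon>)"

definition rect_increment :: "(real \<times> real \<Rightarrow> real) \<Rightarrow> (real \<times> real) set \<Rightarrow> real" where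
  "rect_increment f R =
     (let (p, u) = interval_lowerbound R; (q, v) = interval_upperbound R
      in f (q, v) - f (p, v) - f (q, u) + f (p, u))"

text \<open>Absolute continuity of a function of two variables on the rectangle
  \<open>[a,b] \<times> [c,d]\<close>, in the sense of Caratheodory: the associated rectangle function is
  absolutely continuous with respect to area, and the restrictions of \<open>f\<close> to the two
  sides through the lower left corner are absolutely continuous. Equivalently, \<open>f\<close> is a
  constant plus integrals of Lebesgue integrable functions over \<open>[a,x]\<close>, \<open>[c,y]\<close>
  and \<open>[a,x] \<times> [c,y]\<close>. The condition on the sides cannot be dropped, since adding
  \<open>\<phi> x + \<psi> y\<close> to \<open>f\<close> does not change its rectangle increments.\<close>

definition abs_continuous_on_rect ::
    "real \<Rightarrow> real \<Rightarrow> real \<Rightarrow> real \<Rightarrow> (real \<times> real \<Rightarrow> real) \<Rightarrow> bool" where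
  "abs_continuous_on_rect a b c d f \<longleftrightarrow>
     (\<forall>\<epsilon>>0. \<exists>\<delta>>0. \<forall>\<D>. \<D> division_of \<Union>\<D> \<and> \<Union>\<D> \<subseteq> {a..b} \<times> {c..d} \<and>
        (\<Sum>R\<in>\<D>. measure lborel R) < \<delta> \<longrightarrow> (\<Sum>R\<in>\<D>. \<bar>rect_increment f R\<bar>) < \<epsilon>) \<and>
     abs_continuous_on {a..b} (\<lambda>x. f (x, c)) \<and>
     abs_continuous_on {c..d} (\<lambda>y. f (a, y))"

text \<open>\<open>D\<close> is the mixed partial derivative of \<open>f\<close> on \<open>X \<times> Y\<close>: first differentiate in the
  second variable, then in the first. Derivatives are taken within \<open>X\<close> and \<open>Y\<close>, hence
  are one-sided on the boundary of a rectangle. On a nondegenerate rectangle the values of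
  \<open>D\<close> there are uniquely determined by \<open>f\<close>.\<close>

definition has_mixed_partial_on ::
    "(real \<times> real \<Rightarrow> real) \<Rightarrow> (real \<times> real \<Rightarrow> real) \<Rightarrow> real set \<Rightarrow> real set \<Rightarrow> bool" where
  "has_mixed_partial_on f D X Y \<longleftrightarrow>
     (\<exists>f2. \<forall>x\<in>X. \<forall>y\<in>Y.
        ((\<lambda>v. f (x, v)) has_real_derivative f2 (x, y)) (at y within Y) \<and>
        ((\<lambda>u. f2 (u, y)) has_real_derivative D (x, y)) (at x within X))"

lemma has_mixed_partial_on_unique:
  assumes "a < b" "c < d"
    and D: "has_mixed_partial_on f D {a..b} {c..d}" "has_mixed_partial_on f D' {a..b} {c..d}"
    and xy: "x \<in> {a..b}" "y \<in> {c..d}"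
  shows "D (x, y) = D' (x, y)"
proof -
  have uniq: "D1 = D2"
    if "(h has_real_derivative D1) (at t within {p..q})"
       "(h has_real_derivative D2) (at t within {p..q})" "p < q" "t \<in> {p..q}"
    for h D1 D2 t and p q :: real
    using that
    by (metis has_real_derivative_iff_has_vector_derivative cbox_interval
        vector_derivative_unique_within_closed_interval)
  obtain f2 where f2: "\<And>x y. x \<in> {a..b} \<Longrightarrow> y \<in> {c..d} \<Longrightarrow>
        ((\<lambda>v. f (x, v)) has_real_derivative f2 (x, y)) (at y within {c..d}) \<and>
        ((\<lambda>u. f2 (u, y)) has_real_derivative D (x, y)) (at x within {a..b})"
    using D(1) unfolding has_mixed_partial_on_def by blast
  obtain g2 where g2: "\<And>x y. x \<in> {a..b} \<Longrightarrow> y \<in> {c..d} \<Longrightarrow>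
        ((\<lambda>v. f (x, v)) has_real_derivative g2 (x, y)) (at y within {c..d}) \<and>
        ((\<lambda>u. g2 (u, y)) has_real_derivative D' (x, y)) (at x within {a..b})"
    using D(2) unfolding has_mixed_partial_on_def by blast
  have eq: "f2 (u, y) = g2 (u, y)" if "u \<in> {a..b}" for u
    using f2[OF that xy(2)] g2[OF that xy(2)] uniq \<open>c < d\<close> xy(2) by blast
  have "((\<lambda>u. f2 (u, y)) has_real_derivative D' (x, y)) (at x within {a..b})"
    by (rule has_field_derivative_transform_within[OF _ zero_less_one xy(1)])
      (use g2[OF xy] eq in auto)
  then show ?thesis
    using f2[OF xy] uniq \<open>a < b\<close> xy(1) by blast
qed

end

theory Submission
  imports Defs
begin

text \<open>Let \<open>A\<^sub>x g\<close> be the deviation of the weighted end point value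
  \<open>(g a + r\<^sub>1 g b) / (r\<^sub>1 + 1)\<close> from the mean of \<open>g\<close> over \<open>[a,b]\<close>, and \<open>A\<^sub>y\<close> its
  analogue on \<open>[c,d]\<close>. Integration by parts gives \<open>A\<^sub>x g = \<integral> p g'\<close> with the kernel
  \<open>p x = (x - a) / (b - a) - 1 / (r\<^sub>1 + 1)\<close>. The quantity to be estimated is
  \<open>A\<^sub>x (A\<^sub>y f)\<close>. By \<open>s\<close>-convexity, the mixed derivative is bounded by its values at the
  corners, so dominated convergence allows differentiating \<open>x \<mapsto> A\<^sub>y (f (x, \<cdot>))\<close> under the
  integral sign. The bound then follows by applying the one-dimensional estimate of
  \<open>\<integral> p g'\<close> for \<open>s\<close>-convex \<open>\<bar>g'\<bar>\<close> first in \<open>y\<close>, then in \<open>x\<close>.\<close>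

section \<open>Continuity and differentiation under the integral sign\<close>

lemma abs_continuous_on_imp_continuous_on:
  assumes "abs_continuous_on {a..b} h"
  shows "continuous_on {a..b} h"
  unfolding continuous_on_iff
proof (intro ballI allI impI)
  fix x e :: real
  assume x: "x \<in> {a..b}" and "e > 0"
  then obtain \<delta> where "\<delta> > 0" and \<delta>:
    "\<And>\<D>. \<D> division_of \<Union>\<D> \<Longrightarrow> \<Union>\<D> \<subseteq> {a..b} \<Longrightarrow> (\<Sum>J\<in>\<D>. measure lborel J) < \<delta> \<Longrightarrow>
       (\<Sum>J\<in>\<D>. \<bar>h (interval_upperbound J) - h (interval_lowerbound J)\<bar>) < e"
    using assms unfolding abs_continuous_on_def by meson
  have close: "\<bar>h v - h u\<bar> < e" if "u \<in> {a..b}" "v \<in> {a..b}" "u \<le> v" "v - u < \<delta>" for u v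
  proof -
    \<comment> \<open>A family with a single interval is admissible in the definition, which gives a
      \<open>\<delta>\<close> uniform in the point.\<close>
    have "{cbox u v} division_of \<Union>{cbox u v}"
      using that division_of_self[of u v] by simp
    from \<delta>[OF this] show ?thesis
      using that by auto
  qed
  show "\<exists>d>0. \<forall>y\<in>{a..b}. dist y x < d \<longrightarrow> dist (h y) (h x) < e"
  proof (intro exI[of _ \<delta>] conjI ballI impI \<open>\<delta> > 0\<close>)
    fix y assume "y \<in> {a..b}" "dist y x < \<delta>"
    then show "dist (h y) (h x) < e"
      using close[of x y] close[of y x] x
      by (cases "x \<le> y") (auto simp: dist_real_def abs_minus_commute)
  qed
qed

text \<open>By the mean value inequality \<open>H\<close> dominates the difference quotients in
  \<open>x\<close>, so dominated convergence applies along every sequence tending to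
  \<open>x\<close>. Integrability of \<open>F' x\<close> comes out as that of a dominated pointwise
  limit.\<close>

lemma has_real_derivative_integral_dominated:
  fixes F F' :: "real \<Rightarrow> real \<Rightarrow> real"
  assumes "a < b"
    and int: "\<And>x. x \<in> {a..b} \<Longrightarrow> F x integrable_on S"
    and deriv: "\<And>x y. x \<in> {a..b} \<Longrightarrow> y \<in> S \<Longrightarrow>
      ((\<lambda>u. F u y) has_real_derivative F' x y) (at x within {a..b})"
    and bound: "\<And>x y. x \<in> {a..b} \<Longrightarrow> y \<in> S \<Longrightarrow> \<bar>F' x y\<bar> \<le> H y"
    and H: "H integrable_on S"
    and x: "x \<in> {a..b}"
  shows "F' x integrable_on S"
    and "((\<lambda>u. integral S (F u)) has_real_derivative integral S (F' x)) (at x within {a..b})"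
proof -
  have lim: "F' x integrable_on S \<and>
      (\<lambda>n. (integral S (F (\<xi> n)) - integral S (F x)) / (\<xi> n - x)) \<longlonglongrightarrow> integral S (F' x)"
    if \<xi>: "\<And>n. \<xi> n \<in> {a..b} - {x}" "\<xi> \<longlonglongrightarrow> x" for \<xi> :: "nat \<Rightarrow> real"
  proof -
    define Q where "Q n y = (F (\<xi> n) y - F x y) / (\<xi> n - x)" for n y
    have in_ab: "\<xi> n \<in> {a..b}" and ne: "\<xi> n \<noteq> x" for n
      using \<xi>(1)[of n] by auto
    have Q_int: "Q n integrable_on S" for n
      unfolding Q_def by (intro integrable_on_divide integrable_diff int in_ab x)
    have Q_bound: "norm (Q n y) \<le> H y" if "y \<in> S" for n y
    proof -
      have "norm (F (\<xi> n) y - F x y) \<le> H y * norm (\<xi> n - x)"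
        by (rule field_differentiable_bound[of "{a..b}" "\<lambda>u. F u y" "\<lambda>u. F' u y"])
          (use deriv bound that x in_ab in auto)
      then show ?thesis
        using ne[of n] by (simp add: Q_def field_simps)
    qed
    have Q_lim: "(\<lambda>n. Q n y) \<longlonglongrightarrow> F' x y" if "y \<in> S" for y
      using deriv[OF x that] \<xi>
      unfolding has_field_derivative_iff tendsto_at_iff_sequentially Q_def comp_def by blast
    have "F' x integrable_on S" "(\<lambda>n. integral S (Q n)) \<longlonglongrightarrow> integral S (F' x)"
      using dominated_convergence[OF Q_int H Q_bound Q_lim] by auto
    moreover have "integral S (Q n) = (integral S (F (\<xi> n)) - integral S (F x)) / (\<xi> n - x)" for n
      unfolding Q_def using int in_ab x by (simp add: integral_diff)
    ultimately show ?thesis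
      by simp
  qed
  \<comment> \<open>Integrability of \<open>F' x\<close> requires that at least one such sequence
    exists.\<close>
  have "x islimpt {a..b}"
    using \<open>a < b\<close> x by (simp add: islimpt_Icc)
  then obtain \<xi> where "\<And>n::nat. \<xi> n \<in> {a..b} - {x}" "\<xi> \<longlonglongrightarrow> x"
    by (auto simp: islimpt_sequential)
  with lim show "F' x integrable_on S"
    by blast
  show "((\<lambda>u. integral S (F u)) has_real_derivative integral S (F' x)) (at x within {a..b})"
    unfolding has_field_derivative_iff tendsto_at_iff_sequentially comp_def
    using lim by blast
qed

section \<open>Moments of the kernel\<close>

lemma has_integral_affine_unit:
  fixes h :: "real \<Rightarrow> real"
  assumes "a < b" and h: "(h has_integral i) {0..1}"
  shows "((\<lambda>x. h ((x - a) / (b - a))) has_integral (b - a) * i) {a..b}"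
    and "((\<lambda>x. h ((b - x) / (b - a))) has_integral (b - a) * i) {a..b}"
proof -
  have scale: "((\<lambda>x. k ((x - a) / (b - a))) has_integral (b - a) * i) {a..b}"
    if "(k has_integral i) {0..1}" for k :: "real \<Rightarrow> real"
  proof -
    \<comment> \<open>This is the right end point in the form in which the affine substitution
      produces it.\<close>
    have "(1 - - (a / (b - a))) /\<^sub>R (1 / (b - a)) = b"
      using \<open>a < b\<close> by (simp add: field_simps)
    with has_integral_affinity'[of k i 0 1 "1 / (b - a)" "- (a / (b - a))"] that \<open>a < b\<close>
    show ?thesis
      by (simp add: diff_divide_distrib mult.commute)
  qed
  show "((\<lambda>x. h ((x - a) / (b - a))) has_integral (b - a) * i) {a..b}"
    using h by (rule scale)
  have "((\<lambda>t. h (1 - t)) has_integral i) {0..1}"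
    using has_integral_affinity01[OF h, of "-1" 1] by simp
  moreover have "(b - x) / (b - a) = 1 - (x - a) / (b - a)" for x
    using \<open>a < b\<close> by (simp add: field_simps)
  ultimately show "((\<lambda>x. h ((b - x) / (b - a))) has_integral (b - a) * i) {a..b}"
    using scale[of "\<lambda>t. h (1 - t)"] by simp
qed

text \<open>The modulus changes sign at \<open>\<theta>\<close>. With an antiderivative
  \<open>\<Phi>\<close> of \<open>(t - \<theta>) * t powr s\<close>, the two pieces add up to
  \<open>\<Phi> 1 - 2 * \<Phi> \<theta> + \<Phi> 0\<close>.\<close>

lemma has_integral_abs_diff_powr:
  fixes \<theta> s :: real
  assumes \<theta>: "0 \<le> \<theta>" "\<theta> \<le> 1" and s: "0 < s"
  shows "((\<lambda>t. \<bar>t - \<theta>\<bar> * t powr s) has_integral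
    (s + 1 - \<theta> * (s + 2) + 2 * \<theta> powr (s + 2)) / ((s + 1) * (s + 2))) {0..1}"
proof -
  define \<Phi> where "\<Phi> t = t powr (s + 2) / (s + 2) - \<theta> * (t powr (s + 1) / (s + 1))" for t
  \<comment> \<open>The derivative of \<open>\<Phi>\<close> is computed for positive
    \<open>t\<close> only; continuity up to 0 lets the interior form of the fundamental theorem
    cover intervals starting at 0.\<close>
  have cont: "continuous_on X \<Phi>" if "X \<subseteq> {0..}" for X
    unfolding \<Phi>_def using s that
    by (intro continuous_intros continuous_on_powr') (auto intro!: continuous_intros)
  have deriv: "(\<Phi> has_real_derivative (t - \<theta>) * t powr s) (at t)" if "t > 0" for t
  proof -
    have pow: "((\<lambda>z. z powr p / p) has_real_derivative t powr (p - 1)) (at t)" if "p > 0" for p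
      using DERIV_cdivide[OF has_real_derivative_powr[OF \<open>t > 0\<close>, of p], of p] that by simp
    have "(\<Phi> has_real_derivative t powr (s + 1) - \<theta> * t powr s) (at t)"
      unfolding \<Phi>_def
      using DERIV_diff[OF pow[of "s + 2"] DERIV_cmult[OF pow[of "s + 1"], of \<theta>]] s
      by (simp add: add.commute)
    then show ?thesis
      using \<open>t > 0\<close> by (simp add: powr_add algebra_simps)
  qed
  have \<Phi>0: "\<Phi> 0 = 0"
    using s by (simp add: \<Phi>_def)
  have "((\<lambda>t. (t - \<theta>) * t powr s) has_integral \<Phi> 1 - \<Phi> \<theta>) {\<theta>..1}"
    using \<theta> deriv
    by (intro fundamental_theorem_of_calculus_interior cont)
      (auto simp flip: has_real_derivative_iff_has_vector_derivative)
  then have right: "((\<lambda>t. \<bar>t - \<theta>\<bar> * t powr s) has_integral \<Phi> 1 - \<Phi> \<theta>) {\<theta>..1}"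
    by (rule has_integral_eq[rotated]) auto
  have "((\<lambda>t. - ((t - \<theta>) * t powr s)) has_integral - (\<Phi> \<theta> - \<Phi> 0)) {0..\<theta>}"
    using \<theta> deriv
    by (intro has_integral_neg fundamental_theorem_of_calculus_interior cont)
      (auto simp flip: has_real_derivative_iff_has_vector_derivative)
  then have left: "((\<lambda>t. \<bar>t - \<theta>\<bar> * t powr s) has_integral - (\<Phi> \<theta> - \<Phi> 0)) {0..\<theta>}"
    by (rule has_integral_eq[rotated]) (auto simp: left_diff_distrib)
  have "\<Phi> \<theta> = \<theta> powr (s + 2) * (1 / (s + 2) - 1 / (s + 1))"
    using \<theta> by (cases "\<theta> = 0") (auto simp: \<Phi>_def powr_add powr_numeral power2_eq_square algebra_simps)
  then have "- (\<Phi> \<theta> - \<Phi> 0) + (\<Phi> 1 - \<Phi> \<theta>) =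
      (s + 1 - \<theta> * (s + 2) + 2 * \<theta> powr (s + 2)) / ((s + 1) * (s + 2))"
    using s \<Phi>0 by (simp add: \<Phi>_def divide_simps)
  with has_integral_combine[OF \<theta> left right] show ?thesis
    by simp
qed

definition deviation :: "real \<Rightarrow> real \<Rightarrow> real \<Rightarrow> (real \<Rightarrow> real) \<Rightarrow> real" where
  "deviation r a b g = (g a + r * g b) / (r + 1) - 1 / (b - a) * integral {a..b} g"

text \<open>The additive constant makes the values at \<open>a\<close> and \<open>b\<close> equal to
  \<open>- 1 / (r + 1)\<close> and \<open>r / (r + 1)\<close>, so the boundary terms of the
  integration by parts carry exactly the end point weights.\<close>

definition deviation_kernel :: "real \<Rightarrow> real \<Rightarrow> real \<Rightarrow> real \<Rightarrow> real" where
  "deviation_kernel r a b x = (x - a) / (b - a) - 1 / (r + 1)"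

text \<open>The fundamental theorem integrates the full derivative of the kernel times
  \<open>g\<close>; subtracting the integrable term \<open>g x / (b - a)\<close> leaves the claim.
  Integrability of the product with \<open>g'\<close> is thus a result, as the gauge integral
  recovers every derivative.\<close>

lemma has_integral_kernel_derivative:
  assumes "a < b" "0 \<le> r"
    and deriv: "\<And>x. x \<in> {a..b} \<Longrightarrow> (g has_real_derivative g' x) (at x within {a..b})"
  shows "((\<lambda>x. deviation_kernel r a b x * g' x) has_integral deviation r a b g) {a..b}"
proof -
  have "continuous_on {a..b} g"
    using deriv by (rule DERIV_continuous_on)
  then have "(g has_integral integral {a..b} g) {a..b}"
    by (intro integrable_integral integrable_continuous_interval)
  then have int: "((\<lambda>x. 1 / (b - a) * g x) has_integral 1 / (b - a) * integral {a..b} g) {a..b}"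
    by (rule has_integral_mult_right)
  have "((\<lambda>x. deviation_kernel r a b x * g' x + 1 / (b - a) * g x) has_integral
      deviation_kernel r a b b * g b - deviation_kernel r a b a * g a) {a..b}"
    using \<open>a < b\<close> unfolding deviation_kernel_def
    by (intro fundamental_theorem_of_calculus)
      (auto intro!: derivative_eq_intros deriv
        simp flip: has_real_derivative_iff_has_vector_derivative)
  from has_integral_diff[OF this int] show ?thesis
    using assms(1,2)
    by (simp add: deviation_def deviation_kernel_def divide_simps) (simp add: algebra_simps)
qed

text \<open>Both are instances of the moment on the unit interval: reflected with
  \<open>\<theta> = r / (r + 1)\<close>, and unreflected with \<open>\<theta> = 1 / (r + 1)\<close>.
  The last factors are the constants \<open>M\<close>, \<open>N\<close> and \<open>K\<close>,
  \<open>L\<close> of the final bound.\<close>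

lemma has_integral_abs_kernel_powr:
  fixes r s :: real
  assumes "a < b" "0 \<le> r" "0 < s"
  shows "((\<lambda>x. \<bar>deviation_kernel r a b x\<bar> * ((b - x) / (b - a)) powr s) has_integral
      (b - a) / ((r + 1) * (s + 1) * (s + 2)) *
        (s + 1 + 2 * (r + 1) * (r / (r + 1)) powr (s + 2) - r)) {a..b}"
    and "((\<lambda>x. \<bar>deviation_kernel r a b x\<bar> * ((x - a) / (b - a)) powr s) has_integral
      (b - a) / ((r + 1) * (s + 1) * (s + 2)) *
        (r * (s + 1) + 2 * (1 / (r + 1)) powr (s + 1) - 1)) {a..b}"
proof -
  have "((\<lambda>x. \<bar>(b - x) / (b - a) - r / (r + 1)\<bar> * ((b - x) / (b - a)) powr s) has_integral
      (b - a) * ((s + 1 - r / (r + 1) * (s + 2) + 2 * (r / (r + 1)) powr (s + 2)) /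
        ((s + 1) * (s + 2)))) {a..b}"
    using assms by (intro has_integral_affine_unit(2) has_integral_abs_diff_powr) auto
  moreover have "\<bar>(b - x) / (b - a) - r / (r + 1)\<bar> = \<bar>deviation_kernel r a b x\<bar>" for x
  proof -
    have "(b - x) / (b - a) - r / (r + 1) = - deviation_kernel r a b x"
      using assms by (simp add: deviation_kernel_def divide_simps) (simp add: algebra_simps)
    then show ?thesis
      by simp
  qed
  moreover have "(b - a) * ((s + 1 - r / (r + 1) * (s + 2) + 2 * P) / ((s + 1) * (s + 2))) =
      (b - a) / ((r + 1) * (s + 1) * (s + 2)) * (s + 1 + 2 * (r + 1) * P - r)" for P
    using assms by (simp add: divide_simps) (simp add: algebra_simps)
  ultimately show "((\<lambda>x. \<bar>deviation_kernel r a b x\<bar> * ((b - x) / (b - a)) powr s) has_integral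
      (b - a) / ((r + 1) * (s + 1) * (s + 2)) *
        (s + 1 + 2 * (r + 1) * (r / (r + 1)) powr (s + 2) - r)) {a..b}"
    by simp
  have "((\<lambda>x. \<bar>(x - a) / (b - a) - 1 / (r + 1)\<bar> * ((x - a) / (b - a)) powr s) has_integral
      (b - a) * ((s + 1 - 1 / (r + 1) * (s + 2) + 2 * (1 / (r + 1)) powr (s + 2)) /
        ((s + 1) * (s + 2)))) {a..b}"
    using assms by (intro has_integral_affine_unit(1) has_integral_abs_diff_powr) auto
  \<comment> \<open>One factor is split off to cancel the \<open>r + 1\<close> of the common
    denominator, which lowers the exponent to \<open>s + 1\<close>.\<close>
  moreover have "(1 / (r + 1)) powr (s + 2) = (1 / (r + 1)) powr (s + 1) / (r + 1)"
    using assms powr_add[of "1 / (r + 1)" "s + 1" 1] by (simp add: add.commute)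
  moreover have "(b - a) * ((s + 1 - 1 / (r + 1) * (s + 2) + 2 * (P / (r + 1))) / ((s + 1) * (s + 2))) =
      (b - a) / ((r + 1) * (s + 1) * (s + 2)) * (r * (s + 1) + 2 * P - 1)" for P
    using assms by (simp add: divide_simps) (simp add: algebra_simps)
  ultimately show "((\<lambda>x. \<bar>deviation_kernel r a b x\<bar> * ((x - a) / (b - a)) powr s) has_integral
      (b - a) / ((r + 1) * (s + 1) * (s + 2)) *
        (r * (s + 1) + 2 * (1 / (r + 1)) powr (s + 1) - 1)) {a..b}"
    by (simp add: deviation_kernel_def)
qed

section \<open>Consequences of s-convexity and the one-dimensional estimate\<close>

lemma s_convex_on_bound:
  assumes "s_convex_on s {a..b} h" "a < b" "x \<in> {a..b}"
  shows "h x \<le> ((b - x) / (b - a)) powr s * h a + ((x - a) / (b - a)) powr s * h b"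
proof -
  define t where "t = (x - a) / (b - a)"
  have t: "0 \<le> t" "t \<le> 1" "(b - x) / (b - a) = 1 - t" and x: "x = (1 - t) * a + t * b"
    using assms(2,3) by (auto simp: t_def divide_simps) (simp add: algebra_simps)
  have "h ((1 - t) * a + t * b) \<le> (1 - t) powr s * h a + t powr s * h b"
    using assms t unfolding s_convex_on_def by auto
  then show ?thesis
    unfolding t(3) t_def[symmetric] x[symmetric] .
qed

text \<open>Powers of weights in [0,1] are at most 1. This cruder form supplies a constant majorant
  for dominated convergence.\<close>

lemma s_convex_on_bound_sum:
  assumes "s_convex_on s {a..b} h" "a < b" "x \<in> {a..b}" "0 < s" "0 \<le> h a" "0 \<le> h b"
  shows "h x \<le> h a + h b"
proof -
  have "((b - x) / (b - a)) powr s \<le> 1" "((x - a) / (b - a)) powr s \<le> 1"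
    using assms by (auto intro!: powr_le1 simp: divide_simps)
  then have "((b - x) / (b - a)) powr s * h a + ((x - a) / (b - a)) powr s * h b
      \<le> 1 * h a + 1 * h b"
    using assms by (intro add_mono mult_right_mono) auto
  with s_convex_on_bound[OF assms(1-3)] show ?thesis
    by simp
qed

text \<open>The hypothesis is a pointwise bound with free coefficients \<open>U\<close> and
  \<open>V\<close> instead of s-convexity of the modulus of \<open>h\<close>. It therefore also
  applies to a function such as \<open>G'\<close> below, for which only such a bound is
  derived.\<close>

lemma abs_integral_kernel_le:
  fixes r s :: real
  assumes "a < b" "0 \<le> r" "0 < s"
    and int: "((\<lambda>x. deviation_kernel r a b x * h x) has_integral i) {a..b}"
    and bound: "\<And>x. x \<in> {a..b} \<Longrightarrow>
      \<bar>h x\<bar> \<le> ((b - x) / (b - a)) powr s * U + ((x - a) / (b - a)) powr s * V"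
  shows "\<bar>i\<bar> \<le> (b - a) / ((r + 1) * (s + 1) * (s + 2)) *
      ((s + 1 + 2 * (r + 1) * (r / (r + 1)) powr (s + 2) - r) * U +
       (r * (s + 1) + 2 * (1 / (r + 1)) powr (s + 1) - 1) * V)"
proof -
  let ?C = "(b - a) / ((r + 1) * (s + 1) * (s + 2))"
  let ?P = "s + 1 + 2 * (r + 1) * (r / (r + 1)) powr (s + 2) - r"
  let ?Q = "r * (s + 1) + 2 * (1 / (r + 1)) powr (s + 1) - 1"
  define k where "k = (\<lambda>x. \<bar>deviation_kernel r a b x\<bar> * ((b - x) / (b - a)) powr s * U
      + \<bar>deviation_kernel r a b x\<bar> * ((x - a) / (b - a)) powr s * V)"
  have k: "(k has_integral ?C * ?P * U + ?C * ?Q * V) {a..b}"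
    unfolding k_def
    by (intro has_integral_add has_integral_mult_left has_integral_abs_kernel_powr assms)
  have "norm (integral {a..b} (\<lambda>x. deviation_kernel r a b x * h x)) \<le> integral {a..b} k"
  proof (rule integral_norm_bound_integral)
    fix x assume "x \<in> {a..b}"
    then have "\<bar>deviation_kernel r a b x\<bar> * \<bar>h x\<bar> \<le> \<bar>deviation_kernel r a b x\<bar> *
        (((b - x) / (b - a)) powr s * U + ((x - a) / (b - a)) powr s * V)"
      by (intro mult_left_mono bound) auto
    then show "norm (deviation_kernel r a b x * h x) \<le> k x"
      by (simp add: k_def abs_mult algebra_simps)
  qed (use int k in auto)
  moreover have "integral {a..b} (\<lambda>x. deviation_kernel r a b x * h x) = i" "integral {a..b} k = ?C * ?P * U + ?C * ?Q * V"
    using int k by (auto intro: integral_unique)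
  ultimately show ?thesis
    by (simp only: distrib_left mult.assoc real_norm_def)
qed

text \<open>Up to a positive factor both are integrals of nonnegative functions over [0,1]. The
  signs are needed to insert upper bounds for the values of the mixed derivative.\<close>

lemma kernel_constants_nonneg:
  fixes r s :: real
  assumes "0 \<le> r" "0 < s"
  shows "0 \<le> s + 1 + 2 * (r + 1) * (r / (r + 1)) powr (s + 2) - r" (is "0 \<le> ?P")
    and "0 \<le> r * (s + 1) + 2 * (1 / (r + 1)) powr (s + 1) - 1" (is "0 \<le> ?Q")
proof -
  \<comment> \<open>Written with \<open>1 - 0\<close> to match the moment formula for
    \<open>a = 0\<close> and \<open>b = 1\<close>.\<close>
  let ?C = "(1 - 0) / ((r + 1) * (s + 1) * (s + 2)) :: real"
  have "?C > 0"
    using assms by simp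
  moreover have "0 \<le> ?C * ?P" "0 \<le> ?C * ?Q"
    by (rule has_integral_nonneg[OF has_integral_abs_kernel_powr(1)[OF zero_less_one assms]]
          has_integral_nonneg[OF has_integral_abs_kernel_powr(2)[OF zero_less_one assms]]; simp)+
  ultimately show "0 \<le> ?P" "0 \<le> ?Q"
    by (simp_all only: zero_le_mult_iff) auto
qed

theorem theorem10:
  fixes a b c d s r1 r2 K L M N :: real
    and f D :: "real \<times> real \<Rightarrow> real"
  assumes "a < b" and "c < d"
    and "{a..b} \<times> {c..d} \<subseteq> {0..} \<times> {0..}"
    and "\<And>x y. x \<in> {a..b} \<Longrightarrow> y \<in> {c..d} \<Longrightarrow> f (x, y) \<ge> 0"
    and "abs_continuous_on_rect a b c d f"
    and "0 < s" and "s \<le> 1"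
    and "r1 \<in> {0..1}" and "r2 \<in> {0..1}"
    and "has_mixed_partial_on f D {a..b} {c..d}"
    and "s_convex_on_coordinates s {a..b} {c..d} (\<lambda>z. \<bar>D z\<bar>)"
    and "M = s + 1 + 2 * (r1 + 1) * (r1 / (r1 + 1)) powr (s + 2) - r1"
    and "N = s + 1 + 2 * (r2 + 1) * (r2 / (r2 + 1)) powr (s + 2) - r2"
    and "L = r2 * (s + 1) + 2 * (1 / (r2 + 1)) powr (s + 1) - 1"
    and "K = r1 * (s + 1) + 2 * (1 / (r1 + 1)) powr (s + 1) - 1"
  shows
    "\<bar>(f (a, c) + r2 * f (a, d) + r1 * f (b, c) + r1 * r2 * f (b, d)) / ((r1 + 1) * (r2 + 1))
      - 1 / (d - c) * (r1 / (r1 + 1) * integral {c..d} (\<lambda>y. f (b, y))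
                       + 1 / (r1 + 1) * integral {c..d} (\<lambda>y. f (a, y)))
      - 1 / (b - a) * (r2 / (r2 + 1) * integral {a..b} (\<lambda>x. f (x, d))
                       + 1 / (r2 + 1) * integral {a..b} (\<lambda>x. f (x, c)))
      + 1 / ((b - a) * (d - c)) * integral {a..b} (\<lambda>x. integral {c..d} (\<lambda>y. f (x, y)))\<bar>
     \<le> (b - a) * (d - c) / ((r1 + 1) * (r2 + 1) * (s + 1)\<^sup>2 * (s + 2)\<^sup>2)
        * (M * N * \<bar>D (a, c)\<bar> + L * M * \<bar>D (a, d)\<bar> + K * N * \<bar>D (b, c)\<bar> + K * L * \<bar>D (b, d)\<bar>)"
proof -
  note ab = \<open>a < b\<close> and cd = \<open>c < d\<close> and s = \<open>0 < s\<close>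
  have r: "0 \<le> r1" "0 \<le> r2"
    using assms(8,9) by auto
  obtain f2 where f2:
    "\<And>x y. x \<in> {a..b} \<Longrightarrow> y \<in> {c..d} \<Longrightarrow>
      ((\<lambda>v. f (x, v)) has_real_derivative f2 (x, y)) (at y within {c..d})"
    "\<And>x y. x \<in> {a..b} \<Longrightarrow> y \<in> {c..d} \<Longrightarrow>
      ((\<lambda>u. f2 (u, y)) has_real_derivative D (x, y)) (at x within {a..b})"
    using assms(10) unfolding has_mixed_partial_on_def by blast
  have convex_x: "s_convex_on s {a..b} (\<lambda>u. \<bar>D (u, y)\<bar>)" if "y \<in> {c..d}" for y
    using assms(11) that unfolding s_convex_on_coordinates_def by blast
  have convex_y: "s_convex_on s {c..d} (\<lambda>v. \<bar>D (x, v)\<bar>)" if "x \<in> {a..b}" for x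
    using assms(11) that unfolding s_convex_on_coordinates_def by blast

  \<comment> \<open>Boundedness of the mixed derivative and continuity along the horizontal
    sides\<close>
  define B where "B = \<bar>D (a, c)\<bar> + \<bar>D (b, c)\<bar> + (\<bar>D (a, d)\<bar> + \<bar>D (b, d)\<bar>)"
  have D_le: "\<bar>D (x, y)\<bar> \<le> B" if "x \<in> {a..b}" "y \<in> {c..d}" for x y
  proof -
    have "\<bar>D (x, y)\<bar> \<le> \<bar>D (x, c)\<bar> + \<bar>D (x, d)\<bar>"
      using s_convex_on_bound_sum[OF convex_y cd] that s by simp
    also have "\<dots> \<le> B"
      unfolding B_def using that s cd
      by (intro add_mono s_convex_on_bound_sum[OF convex_x ab]) auto
    finally show ?thesis .
  qed

  have f2_int: "((\<lambda>y. f2 (x, y)) has_integral f (x, d) - f (x, c)) {c..d}" if "x \<in> {a..b}" for x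
    using f2(1)[OF that] cd
    by (intro fundamental_theorem_of_calculus)
      (auto simp flip: has_real_derivative_iff_has_vector_derivative)
  \<comment> \<open>Absolute continuity is given on the side \<open>y = c\<close>; the side
    \<open>y = d\<close> is reached through the difference, an integral of \<open>f2\<close> that
    can be differentiated in \<open>x\<close>.\<close>
  have "continuous_on {a..b} (\<lambda>x. integral {c..d} (\<lambda>y. f2 (x, y)))"
    by (rule DERIV_continuous_on,
        rule has_real_derivative_integral_dominated(2)[where F' = "\<lambda>x y. D (x, y)" and H = "\<lambda>y. B"])
      (use ab f2_int f2 D_le in \<open>auto intro: has_integral_integrable\<close>)
  moreover have "integral {c..d} (\<lambda>y. f2 (x, y)) = f (x, d) - f (x, c)" if "x \<in> {a..b}" for x
    using f2_int[OF that] by (rule integral_unique)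
  ultimately have cont_diff: "continuous_on {a..b} (\<lambda>x. f (x, d) - f (x, c))"
    by (rule continuous_on_eq)
  \<comment> \<open>The mixed derivative says nothing about \<open>f\<close> in its first variable alone, since adding
    \<open>\<phi> x\<close> to \<open>f (x, y)\<close> does not change it.\<close>
  have cont_c: "continuous_on {a..b} (\<lambda>x. f (x, c))"
    using assms(5) abs_continuous_on_imp_continuous_on
    unfolding abs_continuous_on_rect_def by blast
  have cont_d: "continuous_on {a..b} (\<lambda>x. f (x, d))"
    using continuous_on_add[OF cont_diff cont_c] by simp

  \<comment> \<open>Differentiating the deviation in the second variable\<close>
  define G where "G x = deviation r2 c d (\<lambda>y. f (x, y))" for x
  define G' where "G' x = integral {c..d} (\<lambda>y. deviation_kernel r2 c d y * D (x, y))" for x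
  \<comment> \<open>The first variable is differentiated in this representation because the
    derivative in \<open>x\<close> is given for \<open>f2\<close>, not for \<open>f\<close>
    itself.\<close>
  have G_int: "((\<lambda>y. deviation_kernel r2 c d y * f2 (x, y)) has_integral G x) {c..d}" if "x \<in> {a..b}" for x
    unfolding G_def using cd r(2) f2(1)[OF that] by (rule has_integral_kernel_derivative)
  have kernel_int: "(\<lambda>y. \<bar>deviation_kernel r2 c d y\<bar> * B) integrable_on {c..d}"
    unfolding deviation_kernel_def using cd
    by (intro integrable_continuous_interval continuous_intros) auto
  have kernel_D_int: "(\<lambda>y. deviation_kernel r2 c d y * D (x, y)) integrable_on {c..d}"
    and G_deriv_int: "((\<lambda>u. integral {c..d} (\<lambda>y. deviation_kernel r2 c d y * f2 (u, y)))
      has_real_derivative G' x) (at x within {a..b})" if "x \<in> {a..b}" for x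
    unfolding G'_def
    by (rule has_real_derivative_integral_dominated[where F = "\<lambda>x y. deviation_kernel r2 c d y * f2 (x, y)"
            and F' = "\<lambda>x y. deviation_kernel r2 c d y * D (x, y)", OF ab _ _ _ kernel_int that];
        use G_int D_le in \<open>auto intro!: has_integral_integrable DERIV_cmult f2(2) mult_left_mono
          simp: abs_mult\<close>)+
  have G_deriv: "(G has_real_derivative G' x) (at x within {a..b})" if "x \<in> {a..b}" for x
    by (rule has_field_derivative_transform_within[OF G_deriv_int[OF that] zero_less_one that])
      (use G_int in \<open>auto intro: integral_unique\<close>)

  \<comment> \<open>The iterated deviation in expanded form\<close>
  have dev_G: "deviation r1 a b G =
     (f (a, c) + r2 * f (a, d) + r1 * f (b, c) + r1 * r2 * f (b, d)) / ((r1 + 1) * (r2 + 1))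
      - 1 / (d - c) * (r1 / (r1 + 1) * integral {c..d} (\<lambda>y. f (b, y))
                       + 1 / (r1 + 1) * integral {c..d} (\<lambda>y. f (a, y)))
      - 1 / (b - a) * (r2 / (r2 + 1) * integral {a..b} (\<lambda>x. f (x, d))
                       + 1 / (r2 + 1) * integral {a..b} (\<lambda>x. f (x, c)))
      + 1 / ((b - a) * (d - c)) * integral {a..b} (\<lambda>x. integral {c..d} (\<lambda>y. f (x, y)))"
    (is "_ = ?lhs")
  proof -
    have "continuous_on {a..b} G"
      using G_deriv by (rule DERIV_continuous_on)
    \<comment> \<open>Solving the definition of \<open>G\<close> for the inner integral expresses it
      through functions of \<open>x\<close> already known to be continuous, so the outer integral
      exists.\<close>
    then have "continuous_on {a..b}
        (\<lambda>x. (d - c) * ((f (x, c) + r2 * f (x, d)) / (r2 + 1) - G x))"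
      using r by (intro continuous_intros cont_c cont_d) auto
    then have "continuous_on {a..b} (\<lambda>x. integral {c..d} (\<lambda>y. f (x, y)))"
      using cd by (simp add: G_def deviation_def)
    then have ints: "((\<lambda>x. integral {c..d} (\<lambda>y. f (x, y))) has_integral
          integral {a..b} (\<lambda>x. integral {c..d} (\<lambda>y. f (x, y)))) {a..b}"
        "((\<lambda>x. f (x, c)) has_integral integral {a..b} (\<lambda>x. f (x, c))) {a..b}"
        "((\<lambda>x. f (x, d)) has_integral integral {a..b} (\<lambda>x. f (x, d))) {a..b}"
      using cont_c cont_d by (auto intro!: integrable_integral integrable_continuous_interval)
    have "(G has_integral (integral {a..b} (\<lambda>x. f (x, c)) + r2 * integral {a..b} (\<lambda>x. f (x, d))) / (r2 + 1)
        - 1 / (d - c) * integral {a..b} (\<lambda>x. integral {c..d} (\<lambda>y. f (x, y)))) {a..b}"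
      unfolding G_def deviation_def
      by (intro has_integral_diff has_integral_divide has_integral_add has_integral_mult_right ints)
    then have int_G: "integral {a..b} G =
        (integral {a..b} (\<lambda>x. f (x, c)) + r2 * integral {a..b} (\<lambda>x. f (x, d))) / (r2 + 1)
        - 1 / (d - c) * integral {a..b} (\<lambda>x. integral {c..d} (\<lambda>y. f (x, y)))"
      by (rule integral_unique)
    have alg: "((fac + r2 * fad) / (r2 + 1) - 1 / (d - c) * Ia
          + r1 * ((fbc + r2 * fbd) / (r2 + 1) - 1 / (d - c) * Ib)) / (r1 + 1)
        - 1 / (b - a) * ((Ic + r2 * Id) / (r2 + 1) - 1 / (d - c) * I)
      = (fac + r2 * fad + r1 * fbc + r1 * r2 * fbd) / ((r1 + 1) * (r2 + 1))
        - 1 / (d - c) * (r1 / (r1 + 1) * Ib + 1 / (r1 + 1) * Ia)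
        - 1 / (b - a) * (r2 / (r2 + 1) * Id + 1 / (r2 + 1) * Ic)
        + 1 / ((b - a) * (d - c)) * I" for fac fad fbc fbd Ia Ib Ic Id I :: real
    proof -
      \<comment> \<open>With the reciprocals as independent variables the claim is a polynomial
        identity.\<close>
      define p q u v where "p = 1 / (b - a)" "q = 1 / (d - c)" "u = 1 / (r1 + 1)" "v = 1 / (r2 + 1)"
      have "((fac + r2 * fad) * v - q * Ia + r1 * ((fbc + r2 * fbd) * v - q * Ib)) * u
          - p * ((Ic + r2 * Id) * v - q * I)
        = (fac + r2 * fad + r1 * fbc + r1 * r2 * fbd) * (u * v)
          - q * (r1 * u * Ib + u * Ia) - p * (r2 * v * Id + v * Ic) + p * q * I"
        by (simp add: algebra_simps)
      then show ?thesis
        by (simp add: p_q_u_v_def)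
    qed
    show ?thesis
      unfolding deviation_def[of r1] int_G unfolding G_def deviation_def by (rule alg)
  qed

  \<comment> \<open>The estimate in \<open>y\<close>, then in \<open>x\<close>\<close>
  define Cy where "Cy = (d - c) / ((r2 + 1) * (s + 1) * (s + 2))"
  have nonneg: "0 \<le> N" "0 \<le> L" "0 \<le> Cy"
    using kernel_constants_nonneg[OF r(2) s] r s cd by (auto simp: assms(13,14) Cy_def)
  have G'_bound: "\<bar>G' x\<bar> \<le>
      ((b - x) / (b - a)) powr s * (Cy * (N * \<bar>D (a, c)\<bar> + L * \<bar>D (a, d)\<bar>)) +
      ((x - a) / (b - a)) powr s * (Cy * (N * \<bar>D (b, c)\<bar> + L * \<bar>D (b, d)\<bar>))"
    if x: "x \<in> {a..b}" for x
  proof -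
    \<comment> \<open>The estimate in \<open>y\<close> leaves the values of \<open>D\<close> on the
      sides \<open>y = c\<close> and \<open>y = d\<close>; convexity in \<open>x\<close> along these
      sides then reduces them to the corners.\<close>
    have "\<bar>G' x\<bar> \<le> Cy * (N * \<bar>D (x, c)\<bar> + L * \<bar>D (x, d)\<bar>)"
      unfolding Cy_def assms(13,14)
      by (rule abs_integral_kernel_le[OF cd r(2) s _ s_convex_on_bound[OF convex_y[OF x] cd]])
        (use kernel_D_int[OF x] in \<open>auto simp: G'_def intro: integrable_integral\<close>)
    also have "\<dots> \<le> Cy * (
        N * (((b - x) / (b - a)) powr s * \<bar>D (a, c)\<bar> + ((x - a) / (b - a)) powr s * \<bar>D (b, c)\<bar>) +
        L * (((b - x) / (b - a)) powr s * \<bar>D (a, d)\<bar> + ((x - a) / (b - a)) powr s * \<bar>D (b, d)\<bar>))"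
      using nonneg cd
      by (intro mult_left_mono add_mono s_convex_on_bound[OF convex_x ab x]) auto
    finally show ?thesis
      by (simp add: algebra_simps)
  qed
  \<comment> \<open>The coefficients of the two powers in \<open>G'_bound\<close> serve as
    \<open>U\<close> and \<open>V\<close>.\<close>
  have "\<bar>deviation r1 a b G\<bar> \<le> (b - a) / ((r1 + 1) * (s + 1) * (s + 2)) *
      (M * (Cy * (N * \<bar>D (a, c)\<bar> + L * \<bar>D (a, d)\<bar>)) +
       K * (Cy * (N * \<bar>D (b, c)\<bar> + L * \<bar>D (b, d)\<bar>)))"
    unfolding assms(12,15)
    by (rule abs_integral_kernel_le[OF ab r(1) s
          has_integral_kernel_derivative[OF ab r(1) G_deriv] G'_bound])
  also have "\<dots> = (b - a) * (d - c) / ((r1 + 1) * (r2 + 1) * (s + 1)\<^sup>2 * (s + 2)\<^sup>2)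
        * (M * N * \<bar>D (a, c)\<bar> + L * M * \<bar>D (a, d)\<bar> + K * N * \<bar>D (b, c)\<bar> + K * L * \<bar>D (b, d)\<bar>)"
  proof -
    have factor: "C * (M * (Cy * (N * p + L * q)) + K * (Cy * (N * u + L * v)))
        = C * Cy * (M * N * p + L * M * q + K * N * u + K * L * v)" for C p q u v
      by (simp add: algebra_simps)
    show ?thesis
      unfolding factor by (simp add: Cy_def power2_eq_square mult_ac)
  qed
  finally show ?thesis
    unfolding dev_G .
qed

end
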